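(* Let $\mathcal{R}$ be an associative ring with unit $1\neq 0$, let $a,x\in\mathcal{R}$, let $\mathcal{T}$ be a right ideal of $\mathcal{R}$ and let $\mathcal{T}'$ be a left ideal of $\mathcal{R}$. Then the following assertions are equivalent: (1) $x\in a\{1\}$, ${\rm rann}(ax)=\mathcal{T}$, and ${\rm lann}(xa)=\mathcal{T}'$. (2) $\varphi_{ax}=\rho_{a\mathcal{R},\mathcal{T}}$ and ${}_{xa}\varphi=\rho_{\mathcal{R}a,\mathcal{T}'}$. (3) $x=\rho_{\mathcal{R}a,\mathcal{T}'}(1)\,a^{(1)}\,\rho_{a\mathcal{R},\mathcal{T}}(1)+(1-a^{(1)}a)\,y\,(1-aa^{(1)})$ for some $a^{(1)}\in a\{1\}$ and some $y\in\mathcal{R}$.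
   Context: For $a\in\mathcal{R}$: $a\{1\}=\{x\in\mathcal{R}: axa=a\}$; $a\mathcal{R}=\{ar:r\in\mathcal{R}\}$, $\mathcal{R}a=\{ra:r\in\mathcal{R}\}$, ${\rm rann}(a)=\{r\in\mathcal{R}:ar=0\}$, ${\rm lann}(a)=\{r\in\mathcal{R}:ra=0\}$. The additive group endomorphisms $\varphi_a,{}_a\varphi:\mathcal{R}\to\mathcal{R}$ are $\varphi_a(r)=ar$ and ${}_a\varphi(r)=ra$. For additive subgroups $\mathcal{S},\mathcal{T}$ of $\mathcal{R}$, $\mathcal{R}=\mathcal{S}\oplus\mathcal{T}$ means $\mathcal{R}=\mathcal{S}+\mathcal{T}$ and $\mathcal{S}\cap\mathcal{T}=\{0\}$; in that case $\rho_{\mathcal{S},\mathcal{T}}:\mathcal{R}\to\mathcal{R}$ is the group endomorphism $\rho_{\mathcal{S},\mathcal{T}}(s+t)=s$ for $s\in\mathcal{S}$, $t\in\mathcal{T}$. Convention: whenever $\rho_{\mathcal{S},\mathcal{T}}$ is written, it is implicitly asserted that $\mathcal{R}=\mathcal{S}\oplus\mathcal{T}$; thus (2) and (3) each include the assertions $\mathcal{R}=a\mathcal{R}\oplus\mathcal{T}$ and $\mathcal{R}=\mathcal{R}a\oplus\mathcal{T}'$. *)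

theory Defs
  imports Main "HOL-Library.Set_Algebras"
begin

definition add_subgroup :: "'a::ring_1 set \<Rightarrow> bool" where
  "add_subgroup S \<longleftrightarrow> 0 \<in> S \<and> (\<forall>s\<in>S. \<forall>t\<in>S. s + t \<in> S) \<and> (\<forall>s\<in>S. - s \<in> S)"

definition right_ideal :: "'a::ring_1 set \<Rightarrow> bool" where
  "right_ideal T \<longleftrightarrow> add_subgroup T \<and> (\<forall>t\<in>T. \<forall>r. t * r \<in> T)"

definition left_ideal :: "'a::ring_1 set \<Rightarrow> bool" where
  "left_ideal T \<longleftrightarrow> add_subgroup T \<and> (\<forall>t\<in>T. \<forall>r. r * t \<in> T)"

definition inner_inverses :: "'a::ring_1 \<Rightarrow> 'a set" where
  "inner_inverses a = {x. a * x * a = a}"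

definition right_principal :: "'a::ring_1 \<Rightarrow> 'a set" where
  "right_principal a = {a * r | r. True}"

definition left_principal :: "'a::ring_1 \<Rightarrow> 'a set" where
  "left_principal a = {r * a | r. True}"

definition rann :: "'a::ring_1 \<Rightarrow> 'a set" where
  "rann a = {r. a * r = 0}"

definition lann :: "'a::ring_1 \<Rightarrow> 'a set" where
  "lann a = {r. r * a = 0}"

definition lmult :: "'a::ring_1 \<Rightarrow> 'a \<Rightarrow> 'a" where
  "lmult a = (\<lambda>r. a * r)"

definition rmult :: "'a::ring_1 \<Rightarrow> 'a \<Rightarrow> 'a" where
  "rmult a = (\<lambda>r. r * a)"

text \<open>Here \<open>S + T\<close> is the elementwise sum of sets. The predicate is meant for additive
  subgroups \<open>S\<close> and \<open>T\<close>; this is not part of the definition.\<close>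

definition direct_decomp :: "'a::ring_1 set \<Rightarrow> 'a set \<Rightarrow> bool" where
  "direct_decomp S T \<longleftrightarrow> S + T = UNIV \<and> S \<inter> T = {0}"

text \<open>The projection onto \<open>S\<close> along \<open>T\<close>. The description is unique when \<open>S\<close> and \<open>T\<close> are
  additive subgroups with \<open>direct_decomp S T\<close>, and the value is unspecified otherwise, so
  \<open>direct_decomp S T\<close> has to be asserted wherever \<open>proj_along S T\<close> is used.\<close>

definition proj_along :: "'a::ring_1 set \<Rightarrow> 'a set \<Rightarrow> 'a \<Rightarrow> 'a" where
  "proj_along S T r = (THE s. s \<in> S \<and> (\<exists>t\<in>T. r = s + t))"

end

theory Submission
  imports Defs
begin

text \<open>
  Since \<open>T\<close> is a right ideal, the projection onto \<open>aR\<close> along \<open>T\<close> commutes with right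
  multiplication, so it is left multiplication by its value \<open>p\<close> at \<open>1\<close>. Left multiplication by
  \<open>e\<close> is this projection exactly when its image lies in \<open>aR\<close>, it fixes \<open>a\<close>, and its kernel is
  \<open>T\<close>: that is, when \<open>e \<in> aR\<close>, \<open>e * a = a\<close> and \<open>rann e = T\<close>
  (\<open>lmult_eq_proj_along_iff\<close>). On the left ideals the same holds for right multiplication and
  the value \<open>q\<close> at \<open>1\<close> of the projection onto \<open>Ra\<close> along \<open>T'\<close>. For \<open>e = a * x\<close> and
  \<open>e = x * a\<close> the membership is trivial and both fixing conditions say that \<open>x\<close> is an inner
  inverse of \<open>a\<close>; this is the equivalence of the first two assertions.

  The second assertion now reads \<open>a * x = p\<close> and \<open>x * a = q\<close>, a pair of linear equations in
  \<open>x\<close>. The third assertion is its general solution: a particular solution \<open>q * a1 * p\<close> plus the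
  solutions \<open>(1 - a1 * a) * y * (1 - a * a1)\<close> of the homogeneous system
  (\<open>two_sided_equation_solutions\<close>).
\<close>

lemma add_subgroup_right_principal: "add_subgroup (right_principal a)"
  unfolding add_subgroup_def right_principal_def
  by (auto simp flip: distrib_left intro: exI[of _ 0]) (metis mult_minus_right)

lemma add_subgroup_left_principal: "add_subgroup (left_principal a)"
  unfolding add_subgroup_def left_principal_def
  by (auto simp flip: distrib_right intro: exI[of _ 0]) (metis mult_minus_left)

lemma add_subgroup_diff:
  assumes "add_subgroup S" "s \<in> S" "t \<in> S"
  shows "s - t \<in> S"
  using assms unfolding add_subgroup_def by (metis add_uminus_conv_diff)

text \<open>Once the two sets are subgroups in direct sum, this equivalence replaces the definite
  description in all later arguments.\<close>

lemma proj_along_eq_iff: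
  assumes S: "add_subgroup S" and T: "add_subgroup T" and ST: "direct_decomp S T"
  shows "proj_along S T r = s \<longleftrightarrow> s \<in> S \<and> r - s \<in> T"
proof -
  have unique: "u = v" if "u \<in> S" "r - u \<in> T" "v \<in> S" "r - v \<in> T" for u v
  proof -
    have "u - v \<in> S" using that S by (simp add: add_subgroup_diff)
    moreover have "u - v \<in> T"
      using add_subgroup_diff[OF T that(4) that(2)] by simp
    ultimately have "u - v \<in> S \<inter> T" by blast
    then have "u - v = 0" using ST unfolding direct_decomp_def by blast
    then show ?thesis by simp
  qed
  have "r \<in> S + T" using ST by (simp add: direct_decomp_def)
  then obtain u where u: "u \<in> S" "r - u \<in> T"
    by (auto elim!: set_plus_elim)
  have "proj_along S T r = (THE s. s \<in> S \<and> r - s \<in> T)"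
    unfolding proj_along_def by (rule arg_cong[where f = The]) (force simp: algebra_simps)
  also have "\<dots> = u" using u unique by blast
  finally show ?thesis using u unique by blast
qed

text \<open>The kernel part of \<open>r\<close> is \<open>r - f r\<close>, and an element of \<open>S\<close> in the kernel equals its
  own image, which is \<open>0\<close>.\<close>

lemma direct_decomp_retraction:
  assumes add: "\<And>u v. f (u - v) = f u - f v"
    and image: "\<And>r. f r \<in> S" and fixes_S: "\<And>s. s \<in> S \<Longrightarrow> f s = s"
  shows "direct_decomp S {r. f r = 0}"
proof -
  have "r \<in> S + {r. f r = 0}" for r
    using set_plus_intro[of "f r" S "r - f r" "{r. f r = 0}"] add image fixes_S by simp
  moreover have "f 0 = 0" using add[of 0 0] by simp
  ultimately show ?thesis
    using image[of 0] fixes_S unfolding direct_decomp_def by auto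
qed

text \<open>Evaluating the projection at \<open>1\<close> and at \<open>a\<close> gives \<open>e \<in> aR\<close> and \<open>e * a = a\<close>, and its
  zero set is \<open>T\<close>. Conversely, the conditions make left multiplication by \<open>e\<close> a retraction onto
  \<open>aR\<close> with kernel \<open>T\<close>, so the decomposition itself comes out of them.\<close>

lemma lmult_eq_proj_along_iff:
  assumes T: "right_ideal T"
  shows "direct_decomp (right_principal a) T \<and> lmult e = proj_along (right_principal a) T
    \<longleftrightarrow> e \<in> right_principal a \<and> e * a = a \<and> rann e = T"
    (is "?D \<and> ?E \<longleftrightarrow> _")
proof -
  have S: "add_subgroup (right_principal a)" by (rule add_subgroup_right_principal)
  have T': "add_subgroup T" using T by (simp add: right_ideal_def)
  have pointwise: "?E \<longleftrightarrow> (\<forall>r. e * r \<in> right_principal a \<and> r - e * r \<in> T)" if ?D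
    unfolding fun_eq_iff lmult_def
    using proj_along_eq_iff[OF S T' that] by metis
  have a_in: "a \<in> right_principal a"
    unfolding right_principal_def by (metis (mono_tags, lifting) mem_Collect_eq mult_1_right)
  show ?thesis
  proof (intro iffI conjI; (elim conjE)?)
    assume D: ?D and E: ?E
    note char = proj_along_eq_iff[OF S T' D, folded E, unfolded lmult_def]
    show "e \<in> right_principal a" using pointwise[OF D] E by (metis mult_1_right)
    show "e * a = a" using char a_in T' by (simp add: add_subgroup_def)
    show "rann e = T" using char S by (auto simp: rann_def add_subgroup_def)
  next
    assume e: "e \<in> right_principal a" and ea: "e * a = a" and ann: "rann e = T"
    have image: "e * r \<in> right_principal a" for r
      using e unfolding right_principal_def by (auto simp: mult.assoc)
    have fixed: "e * s = s" if "s \<in> right_principal a" for s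
      using that ea unfolding right_principal_def by (auto simp flip: mult.assoc)
    show D: ?D
      using direct_decomp_retraction[of "\<lambda>r. e * r"] image fixed ann
      by (simp add: right_diff_distrib rann_def)
    have "r - e * r \<in> T" for r
      using fixed[OF image] ann by (auto simp: rann_def right_diff_distrib)
    then show ?E using pointwise[OF D] image by blast
  qed
qed

lemma rmult_eq_proj_along_iff:
  assumes T: "left_ideal T"
  shows "direct_decomp (left_principal a) T \<and> rmult e = proj_along (left_principal a) T
    \<longleftrightarrow> e \<in> left_principal a \<and> a * e = a \<and> lann e = T"
    (is "?D \<and> ?E \<longleftrightarrow> _")
proof -
  have S: "add_subgroup (left_principal a)" by (rule add_subgroup_left_principal)
  have T': "add_subgroup T" using T by (simp add: left_ideal_def)
  have pointwise: "?E \<longleftrightarrow> (\<forall>r. r * e \<in> left_principal a \<and> r - r * e \<in> T)" if ?D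
    unfolding fun_eq_iff rmult_def
    using proj_along_eq_iff[OF S T' that] by metis
  have a_in: "a \<in> left_principal a"
    unfolding left_principal_def by (metis (mono_tags, lifting) mem_Collect_eq mult_1_left)
  show ?thesis
  proof (intro iffI conjI; (elim conjE)?)
    assume D: ?D and E: ?E
    note char = proj_along_eq_iff[OF S T' D, folded E, unfolded rmult_def]
    show "e \<in> left_principal a" using pointwise[OF D] E by (metis mult_1_left)
    show "a * e = a" using char a_in T' by (simp add: add_subgroup_def)
    show "lann e = T" using char S by (auto simp: lann_def add_subgroup_def)
  next
    assume e: "e \<in> left_principal a" and ae: "a * e = a" and ann: "lann e = T"
    have image: "r * e \<in> left_principal a" for r
      using e unfolding left_principal_def by (auto simp flip: mult.assoc)
    have fixed: "s * e = s" if "s \<in> left_principal a" for s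
      using that ae unfolding left_principal_def by (auto simp: mult.assoc)
    show D: ?D
      using direct_decomp_retraction[of "\<lambda>r. r * e"] image fixed ann
      by (simp add: left_diff_distrib lann_def)
    have "r - r * e \<in> T" for r
      using fixed[OF image] ann by (auto simp: lann_def left_diff_distrib)
    then show ?E using pointwise[OF D] image by blast
  qed
qed

text \<open>Multiplying the decomposition \<open>1 = p + t\<close> by \<open>r\<close> on the right gives the decomposition
  \<open>r = p * r + t * r\<close>, because \<open>aR\<close> and \<open>T\<close> are both right ideals.\<close>

lemma proj_along_eq_lmult:
  assumes T: "right_ideal T" and D: "direct_decomp (right_principal a) T"
  shows "proj_along (right_principal a) T = lmult (proj_along (right_principal a) T 1)"
proof
  fix r
  let ?p = "proj_along (right_principal a) T 1"
  have "add_subgroup T" using T by (simp add: right_ideal_def)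
  note char = proj_along_eq_iff[OF add_subgroup_right_principal this D]
  have "?p \<in> right_principal a" and t: "1 - ?p \<in> T" using char by blast+
  then have "?p * r \<in> right_principal a"
    unfolding right_principal_def by (auto simp: mult.assoc)
  moreover have "(1 - ?p) * r \<in> T" using T t by (simp add: right_ideal_def)
  ultimately show "proj_along (right_principal a) T r = lmult ?p r"
    using char by (simp add: lmult_def left_diff_distrib)
qed

lemma proj_along_eq_rmult:
  assumes T: "left_ideal T" and D: "direct_decomp (left_principal a) T"
  shows "proj_along (left_principal a) T = rmult (proj_along (left_principal a) T 1)"
proof
  fix r
  let ?q = "proj_along (left_principal a) T 1"
  have "add_subgroup T" using T by (simp add: left_ideal_def)
  note char = proj_along_eq_iff[OF add_subgroup_left_principal this D]
  have "?q \<in> left_principal a" and t: "1 - ?q \<in> T" using char by blast+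
  then have "r * ?q \<in> left_principal a"
    unfolding left_principal_def by (auto simp flip: mult.assoc)
  moreover have "r * (1 - ?q) \<in> T" using T t by (simp add: left_ideal_def)
  ultimately show "proj_along (left_principal a) T r = rmult ?q r"
    using char by (simp add: rmult_def right_diff_distrib)
qed

text \<open>Every \<open>q * a1 * p\<close> solves the system, since \<open>a * a1\<close> fixes \<open>aR\<close> from the left and
  \<open>a1 * a\<close> fixes \<open>Ra\<close> from the right. Conversely, a solution \<open>x\<close> is itself an inner inverse
  and can serve as \<open>a1\<close>: then \<open>q * x * p = x * a * x\<close>, and \<open>y = x\<close> supplies the missing part
  \<open>x - x * a * x\<close>, which vanishes only if \<open>x\<close> is also an outer inverse.\<close>

lemma two_sided_equation_solutions:
  fixes a p q x :: "'a::ring_1"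
  assumes p: "p \<in> right_principal a" "p * a = a" and q: "q \<in> left_principal a" "a * q = a"
  shows "a * x = p \<and> x * a = q \<longleftrightarrow>
    (\<exists>a1\<in>inner_inverses a. \<exists>y. x = q * a1 * p + (1 - a1 * a) * y * (1 - a * a1))"
    (is "?L \<longleftrightarrow> ?R")
proof
  assume L: ?L
  then have axa: "a * x * a = a" using p by simp
  have "q * x * p = x * a * x"
    using L axa by (metis mult.assoc)
  moreover have "(1 - x * a) * x * (1 - a * x) = x - x * a * x"
  proof -
    have "(x - x * a * x) * (a * x) = 0"
      using axa by (simp add: left_diff_distrib mult.assoc) (metis mult.assoc)
    then show ?thesis by (simp add: left_diff_distrib right_diff_distrib)
  qed
  ultimately have "x = q * x * p + (1 - x * a) * x * (1 - a * x)" by simp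
  moreover have "x \<in> inner_inverses a" using axa by (simp add: inner_inverses_def)
  ultimately show ?R by blast
next
  assume ?R
  then obtain a1 y where a1: "a * a1 * a = a"
    and x: "x = q * a1 * p + (1 - a1 * a) * y * (1 - a * a1)"
    by (auto simp: inner_inverses_def)
  have kill: "a * (1 - a1 * a) = 0" "(1 - a * a1) * a = 0"
    using a1 by (simp_all add: right_diff_distrib left_diff_distrib mult.assoc)
  have "a * a1 * p = p"
    using p(1) a1 unfolding right_principal_def by (auto simp flip: mult.assoc)
  moreover have "a * x = (a * q) * a1 * p + (a * (1 - a1 * a)) * y * (1 - a * a1)"
    unfolding x by (simp only: distrib_left mult.assoc)
  ultimately have ax: "a * x = p" using q(2) kill by simp
  have "q * (a1 * a) = q"
    using q(1) a1 unfolding left_principal_def by (auto simp: mult.assoc)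
  moreover have "x * a = q * (a1 * (p * a)) + (1 - a1 * a) * y * ((1 - a * a1) * a)"
    unfolding x by (simp only: distrib_right mult.assoc)
  ultimately have "x * a = q" using p(2) kill by simp
  with ax show ?L by blast
qed

theorem theorem4p4:
  fixes a x :: "'a::ring_1" and T T' :: "'a set"
  assumes "right_ideal T" and "left_ideal T'"
  shows "(x \<in> inner_inverses a \<and> rann (a * x) = T \<and> lann (x * a) = T'
        \<longleftrightarrow>
          direct_decomp (right_principal a) T \<and> direct_decomp (left_principal a) T' \<and>
          lmult (a * x) = proj_along (right_principal a) T \<and>
          rmult (x * a) = proj_along (left_principal a) T')
      \<and>
         (direct_decomp (right_principal a) T \<and> direct_decomp (left_principal a) T' \<and>
          lmult (a * x) = proj_along (right_principal a) T \<and>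
          rmult (x * a) = proj_along (left_principal a) T'
        \<longleftrightarrow>
          direct_decomp (right_principal a) T \<and> direct_decomp (left_principal a) T' \<and>
          (\<exists>a1\<in>inner_inverses a. \<exists>y.
             x = proj_along (left_principal a) T' 1 * a1 * proj_along (right_principal a) T 1
                 + (1 - a1 * a) * y * (1 - a * a1)))"
proof -
  let ?D = "direct_decomp (right_principal a) T" and ?D' = "direct_decomp (left_principal a) T'"
  let ?P = "proj_along (right_principal a) T" and ?Q = "proj_along (left_principal a) T'"
  note right = lmult_eq_proj_along_iff[OF assms(1), of a]
  note left = rmult_eq_proj_along_iff[OF assms(2), of a]
  have "a * x \<in> right_principal a" "x * a \<in> left_principal a"
    by (auto simp: right_principal_def left_principal_def)
  then have one_two: "x \<in> inner_inverses a \<and> rann (a * x) = T \<and> lann (x * a) = T' \<longleftrightarrow>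
      ?D \<and> ?D' \<and> lmult (a * x) = ?P \<and> rmult (x * a) = ?Q"
    using right[of "a * x"] left[of "x * a"] by (auto simp: inner_inverses_def mult.assoc)
  have two_three: "lmult (a * x) = ?P \<and> rmult (x * a) = ?Q \<longleftrightarrow>
      (\<exists>a1\<in>inner_inverses a. \<exists>y. x = ?Q 1 * a1 * ?P 1 + (1 - a1 * a) * y * (1 - a * a1))"
    if D: ?D and D': ?D'
  proof -
    have P: "?P = lmult (?P 1)" and Q: "?Q = rmult (?Q 1)"
      using proj_along_eq_lmult[OF assms(1) D] proj_along_eq_rmult[OF assms(2) D'] .
    have "lmult (a * x) = ?P \<longleftrightarrow> a * x = ?P 1"
      using P by (metis lmult_def mult_1_right)
    moreover have "rmult (x * a) = ?Q \<longleftrightarrow> x * a = ?Q 1"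
      using Q by (metis rmult_def mult_1_left)
    ultimately show ?thesis
      using two_sided_equation_solutions[of "?P 1" a "?Q 1" x]
        right[of "?P 1"] left[of "?Q 1"] P Q D D' by metis
  qed
  from one_two two_three show ?thesis by blast
qed

end
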